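(* Let $m\ge2$ be an even integer, and let $p$ be an $m$-closed P-net such that $p_{i,0}=0$ for all $i\in\mathbb Z$, and such that $$\sum_{\ell=0}^{m-1}(-1)^\ell p_{\ell,1}^{-1}=0 .$$ Assume that the propagation map $T$ can be applied to $(p_0,p_1)$ at least $m-2$ times. Then, for all $i\in\mathbb Z$, $$p_{i,m-1}=\Bigl(\frac1m\sum_{\ell=0}^{m-1}p_{\ell,1}^{-1}\Bigr)^{-1},$$ that is, the singularity repeats after $m-2$ steps and its value is the harmonic mean of $p_1$.
   Context: $\hat{\mathbb C}=\mathbb C\cup\{\infty\}$ is identified with $\mathbb{CP}^1$ with the usual arithmetic. A P-net is a map $p$ with values in $\hat{\mathbb C}$ satisfying $$\frac{1}{p_{i+1,j}-p_{i,j}}-\frac{1}{p_{i,j+1}-p_{i,j}}+\frac{1}{p_{i-1,j}-p_{i,j}}-\frac{1}{p_{i,j-1}-p_{i,j}}=0,$$ equivalently $$\frac{(p_{i,j}-p_{i+1,j})(p_{i,j+1}-p_{i,j})(p_{i-1,j}-p_{i,j-1})}{(p_{i+1,j}-p_{i,j+1})(p_{i,j}-p_{i-1,j})(p_{i,j-1}-p_{i,j})}=-1 .$$ Write $p_j=(p_{i,j})_{i\in\mathbb Z}$. This relation at row $j$ determines $p_{j+1}$ from $(p_{j-1},p_j)$; the propagation map is $T:(p_{j-1},p_j)\mapsto(p_j,p_{j+1})$. $p$ is $m$-closed if $p_{i+m,j}=p_{i,j}$ for all $i,j$. Since $p_0$ is constant, the row $p_{-1}$ is not defined: here $p$ consists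 of the rows $j\ge0$ obtained from $(p_0,p_1)$ by forward propagation, with the relation imposed at rows $j\ge1$. "$T$ can be applied" means that at each step the new values are well defined by the relation; standing assumption: the data are as generic as possible given the stated constraints. *)

theory Defs
  imports Complex_Main
begin

text \<open>The Riemann sphere, with the usual arithmetic. The expressions without a value
  (such as \<open>\<infinity> + \<infinity>\<close>, \<open>0 * \<infinity>\<close>, \<open>\<infinity> / \<infinity>\<close>) are set to \<open>\<infinity>\<close>. Since \<open>\<infinity>\<close> is absorbing for
  addition, a sum has a finite value only if all its terms are finite.\<close>

datatype csphere = Of_complex complex | Infty

instantiation csphere :: comm_monoid_add
begin

definition zero_csphere :: csphere where
  "0 = Of_complex 0"

fun plus_csphere :: "csphere \<Rightarrow> csphere \<Rightarrow> csphere" where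
  "Of_complex z + Of_complex w = Of_complex (z + w)"
| "Infty + y = Infty"
| "x + Infty = Infty"

instance
proof
  fix a b c :: csphere
  show "a + b + c = a + (b + c)" by (cases a; cases b; cases c) auto
  show "a + b = b + a" by (cases a; cases b) auto
  show "0 + a = a" by (cases a) (auto simp: zero_csphere_def)
qed

end

instantiation csphere :: "{minus, uminus, one, times, inverse}"
begin

fun uminus_csphere :: "csphere \<Rightarrow> csphere" where
  "- Of_complex z = Of_complex (- z)"
| "- Infty = Infty"

definition minus_csphere :: "csphere \<Rightarrow> csphere \<Rightarrow> csphere" where
  "x - y = x + (- y)" for x y :: csphere

definition one_csphere :: csphere where
  "1 = Of_complex 1"

fun times_csphere :: "csphere \<Rightarrow> csphere \<Rightarrow> csphere" where
  "Of_complex z * Of_complex w = Of_complex (z * w)"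
| "Infty * y = Infty"
| "x * Infty = Infty"

fun inverse_csphere :: "csphere \<Rightarrow> csphere" where
  "inverse (Of_complex z) = (if z = 0 then Infty else Of_complex (inverse z))"
| "inverse Infty = 0"

definition divide_csphere :: "csphere \<Rightarrow> csphere \<Rightarrow> csphere" where
  "x div y = x * inverse y" for x y :: csphere

instance ..

end

instance csphere :: power ..

text \<open>Homogeneous coordinates on the complex projective line. The bracket of two points is
  the determinant of their coordinates; it replaces the difference in (multi-)ratios.\<close>

fun hom :: "csphere \<Rightarrow> complex \<times> complex" where
  "hom (Of_complex z) = (z, 1)"
| "hom Infty = (1, 0)"

definition bracket :: "csphere \<Rightarrow> csphere \<Rightarrow> complex" where
  "bracket x y = fst (hom x) * snd (hom y) - fst (hom y) * snd (hom x)"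

text \<open>The relation at a point \<open>x\<close> with right, upper, left and lower neighbours \<open>r\<close>, \<open>u\<close>, \<open>l\<close>, \<open>d\<close>:
  the multi-ratio equation \<open>(x-r)(u-x)(l-d) / ((r-u)(x-l)(d-x)) = -1\<close> with the denominator
  cleared and differences read as brackets. Each of the points occurs equally often on both
  sides, so the equation does not depend on the choice of homogeneous coordinates, and it makes
  sense when some of the points are \<open>\<infinity>\<close>. The lemmas below relate it to the equation
  \<open>1/(r-x) - 1/(u-x) + 1/(l-x) - 1/(d-x) = 0\<close>.\<close>

definition P_relation :: "csphere \<Rightarrow> csphere \<Rightarrow> csphere \<Rightarrow> csphere \<Rightarrow> csphere \<Rightarrow> bool" where
  "P_relation x r u l d \<longleftrightarrow>
     bracket x r * bracket u x * bracket l d = - (bracket r u * bracket x l * bracket d x)"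

lemma bracket_simps [simp]:
  "bracket (Of_complex z) (Of_complex w) = z - w"
  "bracket Infty (Of_complex w) = 1"
  "bracket (Of_complex z) Infty = -1"
  "bracket Infty Infty = 0"
  by (auto simp: bracket_def)

lemma bracket_eq_0_iff: "bracket x y = 0 \<longleftrightarrow> x = y"
  by (cases x; cases y) auto

lemma P_relation_multi_ratio:
  assumes "bracket r u \<noteq> 0" "bracket x l \<noteq> 0" "bracket d x \<noteq> 0"
  shows "P_relation x r u l d \<longleftrightarrow>
    (bracket x r * bracket u x * bracket l d) / (bracket r u * bracket x l * bracket d x) = -1"
  using assms by (auto simp: P_relation_def field_simps)

lemma diff_csphere:
  "Of_complex z - Of_complex w = Of_complex (z - w)"
  "Infty - y = Infty"
  "y - Infty = Infty"
  "y + Infty = Infty"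
  by (cases y; simp add: minus_csphere_def)+

lemma P_relation_Of_complex:
  assumes "x = Of_complex z"
  shows "1 / (r - x) - 1 / (u - x) + 1 / (l - x) - 1 / (d - x) = 0 \<longleftrightarrow>
    r \<noteq> x \<and> u \<noteq> x \<and> l \<noteq> x \<and> d \<noteq> x \<and> P_relation x r u l d"
proof -
  define t where "t y = snd (hom y) / bracket y x" for y
  have recip: "1 / (y - x) = (if y = x then Infty else Of_complex (t y))" for y
    by (cases y) (auto simp: assms t_def divide_csphere_def minus_csphere_def
        one_csphere_def zero_csphere_def inverse_eq_divide)
  show ?thesis
  proof (cases "r \<noteq> x \<and> u \<noteq> x \<and> l \<noteq> x \<and> d \<noteq> x")
    case False
    then show ?thesis
      by (auto simp: recip diff_csphere zero_csphere_def)
  next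
    case True
    have snd_hom: "snd (hom y) = t y * bracket y x" if "y \<noteq> x" for y
      using that by (simp add: t_def bracket_eq_0_iff)
    have bracket: "bracket y w = bracket y x * bracket w x * (t w - t y)"
      if "y \<noteq> x" "w \<noteq> x" for y w
    proof -
      have "fst (hom v) = bracket v x + z * snd (hom v)" for v
        by (simp add: bracket_def assms)
      then have "bracket y w = bracket y x * snd (hom w) - bracket w x * snd (hom y)"
        by (simp add: bracket_def[of y w] algebra_simps)
      then show ?thesis
        by (simp add: snd_hom that algebra_simps)
    qed
    have swap: "bracket x y = - bracket y x" for y
      by (simp add: bracket_def)
    have "bracket x r * bracket u x * bracket l d + bracket r u * bracket x l * bracket d x
      = bracket r x * bracket u x * bracket l x * bracket d x * (t r - t u + t l - t d)"
    proof -
      have ld: "bracket l d = bracket l x * bracket d x * (t d - t l)"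
        and ru: "bracket r u = bracket r x * bracket u x * (t u - t r)"
        using True by (blast intro: bracket)+
      show ?thesis
        unfolding swap[of r] swap[of l] ld ru by algebra
    qed
    then have "P_relation x r u l d \<longleftrightarrow> t r - t u + t l - t d = 0"
      using True unfolding P_relation_def eq_neg_iff_add_eq_0 by (simp add: bracket_eq_0_iff)
    then show ?thesis
      using True by (simp add: recip diff_csphere zero_csphere_def)
  qed
qed

lemma P_relation_Infty:
  "P_relation Infty (Of_complex r) (Of_complex u) (Of_complex l) (Of_complex d) \<longleftrightarrow>
    r + l = u + d"
  by (auto simp: P_relation_def algebra_simps)

lemma ex1_linear_form:
  "(\<exists>!u. fst (hom u) * a + snd (hom u) * b = 0) \<longleftrightarrow> a \<noteq> 0 \<or> b \<noteq> 0"
proof (cases "a = 0")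
  case True
  have "\<not> (\<exists>!u :: csphere. True)"
    by (metis csphere.distinct(1))
  moreover have "\<exists>!u. snd (hom u) * b = 0" if "b \<noteq> 0"
  proof (rule ex1I[of _ Infty])
    show "u = Infty" if "snd (hom u) * b = 0" for u
      using that \<open>b \<noteq> 0\<close> by (cases u) auto
  qed simp
  ultimately show ?thesis using True by auto
next
  case False
  have "\<exists>!u. fst (hom u) * a + snd (hom u) * b = 0"
  proof (rule ex1I[of _ "Of_complex (- b / a)"])
    show "u = Of_complex (- b / a)" if "fst (hom u) * a + snd (hom u) * b = 0" for u
      using that False by (cases u) (auto simp: field_simps eq_neg_iff_add_eq_0)
  qed (use False in auto)
  then show ?thesis using False by simp
qed

lemma P_relation_determines_iff:
  "(\<exists>!u. P_relation x r u l d) \<longleftrightarrow>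
    \<not> (r = x \<and> l = x) \<and> \<not> (r = x \<and> d = x) \<and> \<not> (l = x \<and> d = x)"
proof -
  define A where "A = bracket x r * bracket l d"
  define B where "B = bracket x l * bracket d x"
  define a where "a = A * snd (hom x) - B * snd (hom r)"
  define b where "b = B * fst (hom r) - A * fst (hom x)"
  have "P_relation x r u l d \<longleftrightarrow> fst (hom u) * a + snd (hom u) * b = 0" for u
  proof -
    have "bracket x r * bracket u x * bracket l d + bracket r u * bracket x l * bracket d x
        = A * bracket u x + B * bracket r u"
      by (simp add: A_def B_def)
    also have "\<dots> = fst (hom u) * a + snd (hom u) * b"
      by (simp add: bracket_def a_def b_def algebra_simps)
    finally show ?thesis
      unfolding P_relation_def eq_neg_iff_add_eq_0 by simp
  qed
  then have "(\<exists>!u. P_relation x r u l d) \<longleftrightarrow> \<not> (a = 0 \<and> b = 0)"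
    by (simp only: ex1_linear_form de_Morgan_conj)
  also have "a = 0 \<and> b = 0 \<longleftrightarrow> (if r = x then B = 0 else A = 0 \<and> B = 0)"
  proof (cases "r = x")
    case True
    then have "A = 0" by (simp add: A_def bracket_eq_0_iff)
    then show ?thesis using True by (cases x) (auto simp: a_def b_def)
  next
    case False
    then have nz: "bracket x r \<noteq> 0" by (simp add: bracket_eq_0_iff)
    have "- A * bracket x r = a * fst (hom r) + b * snd (hom r)"
      and "- B * bracket x r = a * fst (hom x) + b * snd (hom x)"
      unfolding a_def b_def bracket_def by algebra+
    then have "A = 0 \<and> B = 0" if "a = 0 \<and> b = 0" using nz that by auto
    moreover have "a = 0 \<and> b = 0" if "A = 0 \<and> B = 0" using that by (simp add: a_def b_def)
    ultimately show ?thesis unfolding if_not_P[OF False] by blast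
  qed
  finally have "(\<exists>!u. P_relation x r u l d) \<longleftrightarrow> \<not> (if r = x then B = 0 else A = 0 \<and> B = 0)" .
  moreover have "A = 0 \<longleftrightarrow> r = x \<or> l = d" "B = 0 \<longleftrightarrow> l = x \<or> d = x"
    unfolding A_def B_def mult_eq_0_iff bracket_eq_0_iff by blast+
  ultimately show ?thesis
    by (metis (full_types))
qed

type_synonym row = "int \<Rightarrow> csphere"

text \<open>The propagation map, undefined where the relation does not determine all new values.\<close>

definition propagation :: "row \<times> row \<rightharpoonup> row \<times> row" where
  "propagation = (\<lambda>(q, r).
     if \<forall>i. \<exists>!u. P_relation (r i) (r (i + 1)) u (r (i - 1)) (q i)
     then Some (r, \<lambda>i. THE u. P_relation (r i) (r (i + 1)) u (r (i - 1)) (q i))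
     else None)"

primrec propagation_iter :: "nat \<Rightarrow> row \<times> row \<rightharpoonup> row \<times> row" where
  "propagation_iter 0 s = Some s"
| "propagation_iter (Suc n) s = Option.bind (propagation_iter n s) propagation"

definition can_propagate :: "nat \<Rightarrow> row \<times> row \<Rightarrow> bool" where
  "can_propagate n s \<longleftrightarrow> propagation_iter n s \<noteq> None"

definition row :: "(int \<Rightarrow> nat \<Rightarrow> csphere) \<Rightarrow> nat \<Rightarrow> row" where
  "row p j = (\<lambda>i. p i j)"

text \<open>A P-net with rows \<open>j \<ge> 0\<close> generated by its rows 0 and 1. Row \<open>j + 1\<close> exists as long as the
  propagation map can be applied \<open>j\<close> times to these rows; the relation is imposed only
  between existing rows.\<close>

definition P_net :: "(int \<Rightarrow> nat \<Rightarrow> csphere) \<Rightarrow> bool" where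
  "P_net p \<longleftrightarrow> (\<forall>j\<ge>1. can_propagate j (row p 0, row p 1) \<longrightarrow>
     (\<forall>i. P_relation (p i j) (p (i + 1) j) (p i (j + 1)) (p (i - 1) j) (p i (j - 1))))"

definition m_closed :: "nat \<Rightarrow> (int \<Rightarrow> nat \<Rightarrow> csphere) \<Rightarrow> bool" where
  "m_closed m p \<longleftrightarrow> (\<forall>i j. p (i + int m) j = p i j)"

lemma P_net_propagation_iter:
  assumes "P_net p" "can_propagate n (row p 0, row p 1)"
  shows "propagation_iter n (row p 0, row p 1) = Some (row p n, row p (n + 1))"
  using assms(2)
proof (induction n)
  case 0
  then show ?case by simp
next
  case (Suc n)
  from Suc.prems have "can_propagate n (row p 0, row p 1)"
    by (auto simp: can_propagate_def bind_eq_None_conv)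
  note IH = Suc.IH[OF this]
  let ?R = "\<lambda>i u. P_relation (p i (Suc n)) (p (i + 1) (Suc n)) u (p (i - 1) (Suc n)) (p i n)"
  have ex: "\<forall>i. \<exists>!u. ?R i u"
    using Suc.prems IH
    by (auto simp: can_propagate_def propagation_def row_def split: if_splits)
  have R: "?R i (p i (Suc (Suc n)))" for i
    using assms(1) Suc.prems by (auto simp: P_net_def dest!: spec[of _ "Suc n"])
  have "(THE u. ?R i u) = p i (Suc (Suc n))" for i
    using ex R by (blast intro: the1_equality)
  then show ?case
    using ex IH by (auto simp: propagation_def row_def)
qed

end

theory Submission
  imports Defs "HOL-Computational_Algebra.Polynomial"
begin

text \<open>
  In the coordinate \<open>1/p\<close> the relation is Wynn's cross rule for the Pade table. Writing \<open>S\<close> for the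
  sequence \<open>1/p\<^sub>i\<^sub>,\<^sub>1\<close>, row \<open>j\<close> is therefore a Shanks transform of \<open>S\<close>: there is a polynomial \<open>Q\<close> of
  degree less than \<open>j\<close> in the shift operator such that \<open>Q S\<close> takes one value \<open>N\<close> at the \<open>j\<close> places
  \<open>i - j + 1, \<dots>, i\<close>, and \<open>1/p\<^sub>i\<^sub>,\<^sub>j = N / Q(1)\<close>. Since polynomials in the shift commute, evaluating
  \<open>A B S\<close> in two ways expresses the bracket of two such points by a single coefficient of \<open>B\<close>
  and a single value of \<open>A S - N\<close>; the multi-ratio relation follows by multiplying these expressions.
  A periodic \<open>S\<close> with vanishing alternating sum has a constant image under
  \<open>1 + z\<^sup>2 + \<dots> + z\<^sup>m\<^sup>-\<^sup>2\<close>, which has degree \<open>m - 2\<close>, so row \<open>m - 1\<close> is the mean of \<open>S\<close>.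
\<close>

section \<open>Polynomials in the shift operator\<close>

definition shift_poly :: "(int \<Rightarrow> complex) \<Rightarrow> complex poly \<Rightarrow> int \<Rightarrow> complex" where
  "shift_poly S Q s = (\<Sum>l\<le>degree Q. coeff Q l * S (s + int l))"

lemma shift_poly_eq_sum:
  assumes "\<forall>l\<ge>n. coeff Q l = 0"
  shows "shift_poly S Q s = (\<Sum>l<n. coeff Q l * S (s + int l))"
proof -
  have "shift_poly S Q s = (\<Sum>l<max n (Suc (degree Q)). coeff Q l * S (s + int l))"
    unfolding shift_poly_def
    by (rule sum.mono_neutral_left) (auto simp: coeff_eq_0)
  also have "\<dots> = (\<Sum>l<n. coeff Q l * S (s + int l))"
    using assms by (intro sum.mono_neutral_right) auto
  finally show ?thesis .
qed

lemma poly_1_eq_sum: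
  fixes Q :: "complex poly"
  assumes "\<forall>l\<ge>n. coeff Q l = 0"
  shows "poly Q 1 = (\<Sum>l<n. coeff Q l)"
  using shift_poly_eq_sum[OF assms, of "\<lambda>_. 1"] by (simp add: shift_poly_def poly_altdef)

lemma shift_poly_add: "shift_poly S (A + B) s = shift_poly S A s + shift_poly S B s"
proof -
  define n where "n = Suc (max (degree A) (degree B))"
  have "\<forall>l\<ge>n. coeff A l = 0" "\<forall>l\<ge>n. coeff B l = 0"
    by (auto simp: n_def coeff_eq_0)
  then show ?thesis
    by (simp add: shift_poly_eq_sum[of n] sum.distrib distrib_right)
qed

lemma shift_poly_smult: "shift_poly S (smult c A) s = c * shift_poly S A s"
proof -
  have "\<forall>l\<ge>Suc (degree A). coeff A l = 0"
    by (auto simp: coeff_eq_0)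
  then show ?thesis
    by (simp add: shift_poly_eq_sum[of "Suc (degree A)"] sum_distrib_left mult.assoc del: sum.lessThan_Suc)
qed

lemma shift_poly_pCons_0: "shift_poly S (pCons 0 A) s = shift_poly S A (s + 1)"
proof -
  have "\<forall>l\<ge>Suc (degree A). coeff A l = 0"
    "\<forall>l\<ge>Suc (Suc (degree A)). coeff (pCons 0 A) l = 0"
    by (auto simp: coeff_eq_0 coeff_pCons split: nat.split)
  then show ?thesis
    by (simp add: shift_poly_eq_sum[of "Suc (degree A)"] shift_poly_eq_sum[of "Suc (Suc (degree A))"]
        sum.lessThan_Suc_shift add.assoc del: sum.lessThan_Suc)
qed

lemma shift_poly_const: "shift_poly (\<lambda>_. c) Q t = c * poly Q 1"
  by (simp add: shift_poly_def poly_altdef mult.commute[of c] sum_distrib_right)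

lemma shift_poly_diff_const:
  "shift_poly (\<lambda>s. f s - c) Q t = shift_poly f Q t - c * poly Q 1"
  unfolding shift_poly_const[of c Q t, symmetric]
  by (simp add: shift_poly_def right_diff_distrib sum_subtractf)

lemma shift_poly_commute:
  "shift_poly (shift_poly S A) B t = shift_poly (shift_poly S B) A t"
  unfolding shift_poly_def sum_distrib_left
  by (subst sum.swap) (simp add: mult.left_commute add.assoc add.commute add.left_commute)

lemma shift_poly_first:
  assumes "\<forall>l\<ge>n. coeff Q l = 0" and "\<And>s. t < s \<Longrightarrow> s < t + int n \<Longrightarrow> f s = 0"
  shows "shift_poly f Q t = coeff Q 0 * f t"
proof (cases n)
  case 0
  then show ?thesis using assms(1) by (simp add: shift_poly_eq_sum[OF assms(1)])
next
  case (Suc k)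
  have "(\<Sum>l<k. coeff Q (Suc l) * f (t + int (Suc l))) = 0"
    using assms(2) Suc by (intro sum.neutral) auto
  then show ?thesis
    by (simp add: shift_poly_eq_sum[OF assms(1)] Suc sum.lessThan_Suc_shift del: sum.lessThan_Suc)
qed

section \<open>Approximants and their brackets\<close>

text \<open>Here \<open>x\<close> is a point of the P-net, so \<open>Q(1) : N\<close>, with \<open>N\<close> the common value of \<open>Q S\<close>, are
  homogeneous coordinates of \<open>x\<close> and not of \<open>1/x\<close>. For \<open>j = 0\<close> this forces \<open>Q = 0\<close> and \<open>x = 0\<close>.\<close>

definition approximant :: "(int \<Rightarrow> complex) \<Rightarrow> nat \<Rightarrow> int \<Rightarrow> complex poly \<Rightarrow> csphere \<Rightarrow> bool" where
  "approximant S j i Q x \<longleftrightarrow> (\<forall>l\<ge>j. coeff Q l = 0) \<and> poly Q 1 = fst (hom x) \<and>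
     (\<forall>s\<in>{i - int j<..i}. shift_poly S Q s = snd (hom x))"

text \<open>Commutation turns the bracket into \<open>B\<close> applied to \<open>?f\<close> minus
  \<open>A\<close> applied to \<open>?g\<close>, both at \<open>t\<close>. The bounds on
  \<open>t\<close> make \<open>?g\<close> vanish at all places that \<open>A\<close> reads, and
  \<open>?f\<close> at all places that \<open>B\<close> reads except \<open>t\<close>
  itself.\<close>

lemma bracket_approximants:
  assumes A: "approximant S j i A x" and B: "approximant S k h B y"
    and "i - int j \<le> t" "t + int k - 1 \<le> i" "h - int k < t" "t + int j - 1 \<le> h"
  shows "bracket x y = coeff B 0 * (shift_poly S A t - snd (hom x))"
proof -
  let ?f = "\<lambda>s. shift_poly S A s - snd (hom x)" and ?g = "\<lambda>s. shift_poly S B s - snd (hom y)"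
  have "bracket x y = shift_poly ?f B t - shift_poly ?g A t"
    using A B by (simp add: shift_poly_diff_const shift_poly_commute[of S A] bracket_def approximant_def
        mult.commute)
  also have "shift_poly ?f B t = coeff B 0 * ?f t"
    using assms by (intro shift_poly_first[of k]) (auto simp: approximant_def)
  also have "shift_poly ?g A t = 0"
    using assms unfolding shift_poly_eq_sum[of j A] approximant_def
    by (subst shift_poly_eq_sum[of j]) (auto intro!: sum.neutral)
  finally show ?thesis by simp
qed

lemma bracket_commute: "bracket y x = - bracket x y"
  by (simp add: bracket_def)

text \<open>Each of the six brackets is a constant coefficient times a defect. Up to sign, both
  sides of the relation are the product of \<open>coeff X 0\<close>, \<open>coeff U 0\<close>,
  \<open>coeff L 0\<close>, \<open>f\<close>, \<open>g\<close> and \<open>h\<close>.\<close>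

lemma P_relation_approximants:
  assumes x: "approximant S j i X x" and r: "approximant S j (i + 1) R r"
    and l: "approximant S j (i - 1) L l" and u: "approximant S (Suc j) i U u"
    and d: "approximant S (j - 1) i D d" and "1 \<le> j"
  shows "P_relation x r u l d"
proof -
  let ?n = "i - int j + 1"
  \<comment> \<open>Each defect is taken at the last place before the window of \<open>R\<close>,
    \<open>X\<close> or \<open>D\<close> respectively.\<close>
  define f where "f = shift_poly S R ?n - snd (hom r)"
  define g where "g = shift_poly S X (?n - 1) - snd (hom x)"
  define h where "h = shift_poly S D ?n - snd (hom d)"
  have rx: "bracket r x = coeff X 0 * f"
    unfolding f_def by (rule bracket_approximants[OF r x]) auto
  have ru: "bracket r u = coeff U 0 * f"
    unfolding f_def by (rule bracket_approximants[OF r u]) auto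
  have xu: "bracket x u = coeff U 0 * g"
    unfolding g_def by (rule bracket_approximants[OF x u]) auto
  have xl: "bracket x l = coeff L 0 * g"
    unfolding g_def by (rule bracket_approximants[OF x l]) auto
  have dl: "bracket d l = coeff L 0 * h"
    unfolding h_def using \<open>1 \<le> j\<close> by (intro bracket_approximants[OF d l]) auto
  have dx: "bracket d x = coeff X 0 * h"
    unfolding h_def using \<open>1 \<le> j\<close> by (intro bracket_approximants[OF d x]) auto
  show ?thesis
    unfolding P_relation_def bracket_commute[of x r] bracket_commute[of u x] bracket_commute[of l d]
    by (simp add: rx ru xu xl dl dx)
qed

section \<open>Existence of the next approximant\<close>

lemma hom_proportional:
  assumes "a \<noteq> 0 \<or> b \<noteq> 0"
  obtains x c where "fst (hom x) = c * a" "snd (hom x) = c * b"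
proof (cases "b = 0")
  case True
  then show ?thesis using assms that[of Infty "1 / a"] by simp
next
  case False
  then show ?thesis using that[of "Of_complex (a / b)" "1 / b"] by simp
qed

text \<open>Extending the window \<open>W\<close> by \<open>t\<close> is one homogeneous linear
  condition on a combination of \<open>A\<close> and \<open>B\<close>, so it has a nontrivial
  solution. Since \<open>x \<noteq> y\<close>, the coordinates of the combination do not both
  vanish, and \<open>c\<close> rescales them to those chosen by \<open>hom\<close>.\<close>

lemma combine_approximants:
  assumes A: "\<forall>l\<ge>j. coeff A l = 0" "poly A 1 = fst (hom x)" "\<forall>s\<in>W. shift_poly S A s = snd (hom x)"
    and B: "\<forall>l\<ge>j. coeff B l = 0" "poly B 1 = fst (hom y)" "\<forall>s\<in>W. shift_poly S B s = snd (hom y)"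
    and "x \<noteq> y" and W: "{i - int j<..i} = insert t W"
  shows "\<exists>Q u. approximant S j i Q u"
proof -
  define f where "f = shift_poly S A t - snd (hom x)"
  define g where "g = shift_poly S B t - snd (hom y)"
  obtain \<alpha> \<beta> where ab: "\<alpha> \<noteq> 0 \<or> \<beta> \<noteq> 0" "\<alpha> * f + \<beta> * g = 0"
  proof (cases "f = 0 \<and> g = 0")
    case True
    then show ?thesis using that[of 1 1] by simp
  next
    case False
    then show ?thesis using that[of "- g" f] by auto
  qed
  define a where "a = \<alpha> * fst (hom x) + \<beta> * fst (hom y)"
  define b where "b = \<alpha> * snd (hom x) + \<beta> * snd (hom y)"
  \<comment> \<open>Cramer's rule recovers the weights from \<open>a\<close> and
    \<open>b\<close>.\<close>
  have "\<alpha> * bracket x y = a * snd (hom y) - b * fst (hom y)"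
    "\<beta> * bracket x y = b * fst (hom x) - a * snd (hom x)"
    unfolding a_def b_def bracket_def by algebra+
  then have "a \<noteq> 0 \<or> b \<noteq> 0"
    using ab(1) \<open>x \<noteq> y\<close> bracket_eq_0_iff[of x y] by auto
  then obtain u c where u: "fst (hom u) = c * a" "snd (hom u) = c * b"
    by (rule hom_proportional)
  define Q where "Q = smult c (smult \<alpha> A + smult \<beta> B)"
  have Q: "shift_poly S Q s = c * (\<alpha> * shift_poly S A s + \<beta> * shift_poly S B s)" for s
    by (simp add: Q_def shift_poly_smult shift_poly_add)
  have "\<alpha> * shift_poly S A t + \<beta> * shift_poly S B t = b"
    using ab(2) unfolding f_def g_def b_def by algebra
  then have "approximant S j i Q u"
    unfolding approximant_def W
    using A B by (auto simp: u Q a_def b_def) (auto simp: Q_def)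
  then show ?thesis by blast
qed

text \<open>Multiplication by the shift moves a window down by one place. Thus
  \<open>pCons 0 R\<close> and \<open>X\<close> share a window, as do \<open>L\<close> and
  \<open>pCons 0 X\<close>; at least one of the two pairs represents distinct points and can be
  combined.\<close>

lemma approximant_next:
  assumes x: "approximant S j i X x" and r: "approximant S j (i + 1) R r"
    and l: "approximant S j (i - 1) L l" and "\<not> (r = x \<and> l = x)"
  shows "\<exists>U u. approximant S (Suc j) i U u"
proof (cases "r = x")
  case False
  show ?thesis
  proof (rule combine_approximants[where A = "pCons 0 R" and x = r and B = X and y = x])
    show "{i - int (Suc j)<..i} = insert (i - int j) {i - int j<..i}" by auto
  qed (use False x r in \<open>auto simp: approximant_def shift_poly_pCons_0 coeff_pCons split: nat.split\<close>)
next
  case True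
  then have "l \<noteq> x" using assms(4) by simp
  show ?thesis
  proof (rule combine_approximants[where A = L and x = l and B = "pCons 0 X" and y = x])
    show "{i - int (Suc j)<..i} = insert i {i - 1 - int j<..i - 1}" by auto
  qed (use \<open>l \<noteq> x\<close> x l in \<open>auto simp: approximant_def shift_poly_pCons_0 coeff_pCons split: nat.split\<close>)
qed

section \<open>Rows of the P-net as approximants\<close>

lemma propagation_determines:
  assumes "P_net p" "can_propagate (Suc n) (row p 0, row p 1)"
  shows "\<exists>!u. P_relation (p i (Suc n)) (p (i + 1) (Suc n)) u (p (i - 1) (Suc n)) (p i n)"
proof -
  have "can_propagate n (row p 0, row p 1)"
    using assms(2) by (auto simp: can_propagate_def bind_eq_None_conv)
  from P_net_propagation_iter[OF assms(1) this]
  have "propagation (row p n, row p (Suc n)) \<noteq> None"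
    using assms(2) by (simp add: can_propagate_def)
  then show ?thesis
    by (simp add: propagation_def row_def split: if_splits)
qed

lemma can_propagate_mono:
  assumes "can_propagate n s" "k \<le> n"
  shows "can_propagate k s"
  using assms(2,1)
  by (induction k rule: inc_induct) (auto simp: can_propagate_def bind_eq_None_conv)

text \<open>By induction on the two preceding rows. The approximant built from row
  \<open>j - 1\<close> satisfies the relation, and the uniqueness required by propagation identifies
  its point with the point of the net.\<close>

lemma P_net_approximant:
  assumes "P_net p" and p0: "\<And>i. p i 0 = 0" and p1: "\<And>i. inverse (p i 1) = Of_complex (S i)"
    and "can_propagate n (row p 0, row p 1)" "j \<le> Suc n"
  shows "\<exists>Q. approximant S j i Q (p i j)"
  using assms(5)
proof (induction j arbitrary: i rule: less_induct)
  case (less j)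
  consider "j = 0" | "j = 1" | k where "j = Suc (Suc k)"
    by (metis One_nat_def not0_implies_Suc)
  then show ?case
  proof cases
    case 1
    then have "approximant S j i 0 (p i j)"
      by (simp add: approximant_def p0 zero_csphere_def)
    then show ?thesis by blast
  next
    case 2
    \<comment> \<open>This form also covers \<open>p i 1 = Infty\<close>, where
      \<open>S i = 0\<close>.\<close>
    have *: "fst (hom (p i 1)) * S i = snd (hom (p i 1))"
      using p1[of i] by (cases "p i 1") (auto simp: zero_csphere_def field_simps split: if_splits)
    have window: "{i - 1<..i} = {i}" by auto
    have "approximant S j i [:fst (hom (p i 1)):] (p i j)"
      using 2 *
      by (auto simp: approximant_def shift_poly_def coeff_pCons window split: nat.split)
    then show ?thesis by blast
  next
    case (3 k)
    let ?u = "p i (Suc (Suc k))"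
    have can: "can_propagate (Suc k) (row p 0, row p 1)"
      using can_propagate_mono[OF assms(4)] less.prems 3 by simp
    then have rel: "P_relation (p i (Suc k)) (p (i + 1) (Suc k)) ?u (p (i - 1) (Suc k)) (p i k)"
      using assms(1) by (auto simp: P_net_def dest!: spec[of _ "Suc k"])
    have ex1: "\<exists>!u. P_relation (p i (Suc k)) (p (i + 1) (Suc k)) u (p (i - 1) (Suc k)) (p i k)"
      by (rule propagation_determines[OF assms(1) can])
    have "\<exists>Q. approximant S (Suc k) h Q (p h (Suc k))" "\<exists>Q. approximant S k h Q (p h k)" for h
      using less 3 by auto
    then obtain X R L D where appr: "approximant S (Suc k) i X (p i (Suc k))"
      "approximant S (Suc k) (i + 1) R (p (i + 1) (Suc k))"
      "approximant S (Suc k) (i - 1) L (p (i - 1) (Suc k))" "approximant S k i D (p i k)"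
      by meson
    obtain U u where u: "approximant S (Suc (Suc k)) i U u"
      using approximant_next[OF appr(1-3)] ex1 unfolding P_relation_determines_iff by blast
    have "P_relation (p i (Suc k)) (p (i + 1) (Suc k)) u (p (i - 1) (Suc k)) (p i k)"
      using P_relation_approximants[OF appr(1-3) u] appr(4) by simp
    then have "u = ?u" using ex1 rel by blast
    then show ?thesis using u 3 by blast
  qed
qed

section \<open>Sums on the sphere and periodic sequences\<close>

lemma sum_csphere_Of_complex:
  assumes "\<And>l. l \<in> A \<Longrightarrow> f l = Of_complex (g l)"
  shows "(\<Sum>l\<in>A. f l) = Of_complex (\<Sum>l\<in>A. g l)"
  using assms by (induction A rule: infinite_finite_induct) (auto simp: zero_csphere_def)

lemma sum_csphere_finite:
  assumes "finite A" "(\<Sum>l\<in>A. f l) \<noteq> Infty" "l \<in> A"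
  shows "f l \<noteq> Infty"
proof
  assume "f l = Infty"
  then have "(\<Sum>l\<in>A. f l) = Infty"
    using assms(1,3) by (simp add: sum.remove)
  then show False using assms(2) by simp
qed

lemma minus_one_power_csphere: "(- 1 :: csphere) ^ l = Of_complex ((- 1) ^ l)"
  by (induction l) (auto simp: one_csphere_def)

lemma sum_alternate_terms:
  "(\<Sum>l<2 * k. if even l then f l else 0) = (\<Sum>t<k. f (2 * t))" for f :: "nat \<Rightarrow> complex"
  by (induction k) auto

lemma periodic_sum_shift:
  fixes S :: "int \<Rightarrow> complex"
  assumes "\<And>i. S (i + int m) = S i"
  shows "(\<Sum>l<m. S (s + int l)) = (\<Sum>l<m. S (int l))"
proof -
  have step: "(\<Sum>l<m. S (s + 1 + int l)) = (\<Sum>l<m. S (s + int l))" for s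
  proof -
    have "S s + (\<Sum>l<m. S (s + 1 + int l)) = (\<Sum>l<Suc m. S (s + int l))"
      by (simp add: sum.lessThan_Suc_shift add.assoc del: sum.lessThan_Suc)
    also have "\<dots> = (\<Sum>l<m. S (s + int l)) + S s"
      by (simp add: assms)
    finally show ?thesis by simp
  qed
  show ?thesis
  proof (induction s rule: int_induct[where k = 0])
    case (step2 i)
    then show ?case using step[of "i - 1"] by simp
  qed (use step in simp_all)
qed

text \<open>Adjacent values of \<open>E\<close> add up to the full period sum, so they are equal
  exactly when either one is half of it. The alternating sum gives \<open>E 0 = E 1\<close>, and
  this equality spreads in both directions.\<close>

lemma alternate_sum_periodic:
  fixes S :: "int \<Rightarrow> complex"
  assumes per: "\<And>i. S (i + int (2 * k)) = S i"
    and alt: "(\<Sum>l<2 * k. (- 1) ^ l * S (int l)) = 0"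
  shows "2 * (\<Sum>t<k. S (s + 2 * int t)) = (\<Sum>l<2 * k. S (int l))"
proof -
  define E where "E s = (\<Sum>t<k. S (s + 2 * int t))" for s
  have split: "(\<Sum>l<2 * k. c l * S (s + int l))
      = (\<Sum>t<k. c (2 * t) * S (s + 2 * int t)) + (\<Sum>t<k. c (Suc (2 * t)) * S (s + 1 + 2 * int t))"
    for c s
    by (induction k) (auto simp: algebra_simps)
  have total: "E s + E (s + 1) = (\<Sum>l<2 * k. S (int l))" for s
    using split[of "\<lambda>_. 1" s] periodic_sum_shift[of S "2 * k" s, OF per] by (simp add: E_def)
  have "E 0 = E 1"
    using split[of "\<lambda>l. (- 1) ^ l" 0] alt by (simp add: E_def sum_negf)
  moreover have eq: "E (s + 1) = E s \<longleftrightarrow> 2 * E s = (\<Sum>l<2 * k. S (int l))"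
    "E (s + 1) = E s \<longleftrightarrow> 2 * E (s + 1) = (\<Sum>l<2 * k. S (int l))" for s
    unfolding total[of s, symmetric] by auto
  ultimately have "2 * E s = (\<Sum>l<2 * k. S (int l))"
  proof (induction s rule: int_induct[where k = 0])
    case base
    then show ?case using eq(1)[of 0] by simp
  next
    case (step1 i)
    then show ?case using eq[of i] by simp
  next
    case (step2 i)
    then show ?case using eq[of "i - 1"] by simp
  qed
  then show ?thesis by (simp add: E_def)
qed

theorem theorem4p5:
  fixes m :: nat and p :: "int \<Rightarrow> nat \<Rightarrow> csphere"
  assumes "m \<ge> 2" and "even m"
    and "P_net p" and "m_closed m p"
    and "\<And>i. p i 0 = 0"
    and "(\<Sum>l = 0..m - 1. (- 1) ^ l * inverse (p (int l) 1)) = 0"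
    and "can_propagate (m - 2) (row p 0, row p 1)"
  shows "\<forall>i. p i (m - 1) =
    inverse (Of_complex (1 / of_nat m) * (\<Sum>l = 0..m - 1. inverse (p (int l) 1)))"
proof
  fix i
  obtain k where m: "m = 2 * k" using \<open>even m\<close> by blast
  then have "k \<ge> 1" using \<open>m \<ge> 2\<close> by simp
  have ivl: "{0..m - 1} = {..<m}" using \<open>m \<ge> 2\<close> by auto
  \<comment> \<open>The default 0 is a placeholder: the fact \<open>S\<close> below shows that these
    inverses are all finite.\<close>
  define S where "S i = (case inverse (p i 1) of Of_complex z \<Rightarrow> z | Infty \<Rightarrow> 0)" for i
  have shift: "p (i + int m) j = p i j" for i j
    using \<open>m_closed m p\<close> by (simp add: m_closed_def)
  have mult: "p (i + int m * c) j = p i j" for i j c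
  proof (induction c rule: int_induct[where k = 0])
    case (step1 c)
    then show ?case using shift[of "i + int m * c" j] by (simp add: algebra_simps)
  next
    case (step2 c)
    then show ?case using shift[of "i + int m * (c - 1)" j] by (simp add: algebra_simps)
  qed simp
  have S: "inverse (p i 1) = Of_complex (S i)" for i
  proof -
    define l where "l = nat (i mod int m)"
    have "i = int l + int m * (i div int m)" "l \<in> {..<m}"
      using \<open>m \<ge> 2\<close> by (auto simp: l_def nat_less_iff)
    then have "p i 1 = p (int l) 1" by (metis mult)
    \<comment> \<open>The alternating sum has the finite value 0, and \<open>Infty\<close> absorbs
      under addition.\<close>
    moreover have "(- 1) ^ l * inverse (p (int l) 1) \<noteq> Infty"
      using assms(6) \<open>l \<in> {..<m}\<close> unfolding ivl zero_csphere_def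
      by (intro sum_csphere_finite[where A = "{..<m}" and f = "\<lambda>l. (- 1) ^ l * inverse (p (int l) 1)"])
        (simp_all del: times_csphere.simps)
    ultimately show ?thesis
      by (auto simp: S_def minus_one_power_csphere split: csphere.split)
  qed
  let ?\<sigma> = "\<Sum>l<m. S (int l)"
  have "(\<Sum>l = 0..m - 1. (- 1) ^ l * inverse (p (int l) 1))
      = Of_complex (\<Sum>l<m. (- 1) ^ l * S (int l))"
    unfolding ivl by (rule sum_csphere_Of_complex) (simp only: S minus_one_power_csphere times_csphere.simps)
  then have "(\<Sum>l<2 * k. (- 1) ^ l * S (int l)) = 0"
    using assms(6) by (simp add: zero_csphere_def m)
  moreover have "S (i + int (2 * k)) = S i" for i
    using shift[of i 1] by (simp add: S_def m)
  ultimately have half: "2 * (\<Sum>t<k. S (s + 2 * int t)) = ?\<sigma>" for s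
    unfolding m by (rule alternate_sum_periodic[rotated])

  define \<chi> :: "complex poly" where "\<chi> = (\<Sum>t<k. monom 1 (2 * t))"
  have coeff: "coeff \<chi> l = (if l < m \<and> even l then 1 else 0)" for l
  proof -
    have "coeff \<chi> l = (\<Sum>t<k. if 2 * t = l then 1 else 0)"
      by (simp add: \<chi>_def coeff_sum)
    also have "\<dots> = (if l < m \<and> even l then 1 else 0)"
      by (auto simp: m elim!: evenE intro!: sum.neutral)
    finally show ?thesis .
  qed
  \<comment> \<open>The bound is \<open>m - 1\<close>, not just \<open>m\<close>, because
    \<open>m - 1\<close> is odd. Hence \<chi> reads only \<open>m - 1\<close> places, the window
    length of row \<open>m - 1\<close>.\<close>
  have deg: "\<forall>l\<ge>m - 1. coeff \<chi> l = 0"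
  proof (intro allI impI)
    show "coeff \<chi> l = 0" if "l \<ge> m - 1" for l
      using that \<open>even m\<close> \<open>m \<ge> 2\<close> by (cases "l = m - 1") (auto simp: coeff)
  qed
  then have "\<forall>l\<ge>m. coeff \<chi> l = 0" by simp
  then have apply_\<chi>: "shift_poly S \<chi> s = ?\<sigma> / 2" for s
    unfolding half[of s, symmetric]
    using sum_alternate_terms[of "\<lambda>l. S (s + int l)" k]
    by (simp add: shift_poly_eq_sum[of m] coeff m if_distrib[of "\<lambda>c. c * _"] cong: if_cong)
  have \<chi>_1: "poly \<chi> 1 = of_nat k"
    by (simp add: \<chi>_def poly_sum poly_monom)

  \<comment> \<open>Applying \<open>T\<close> \<open>m - 2\<close> times yields the rows up to
    \<open>m - 1\<close>.\<close>
  obtain Q where Q: "approximant S (m - 1) i Q (p i (m - 1))"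
    using P_net_approximant[OF \<open>P_net p\<close> assms(5) S assms(7)] \<open>m \<ge> 2\<close> by fastforce
  \<comment> \<open>The product of \<chi> and \<open>Q\<close> is applied to \<open>S\<close> at the
    first place of the window of \<open>Q\<close>. One order sees the constant image under \<chi>,
    the other the constant value of \<open>Q\<close> on its window.\<close>
  have "fst (hom (p i (m - 1))) * (?\<sigma> / 2) = shift_poly (shift_poly S \<chi>) Q (i - int (m - 1) + 1)"
    using Q by (simp add: approximant_def shift_poly_const ext[of "shift_poly S \<chi>", OF apply_\<chi>])
  also have "\<dots> = shift_poly (shift_poly S Q) \<chi> (i - int (m - 1) + 1)"
    by (rule shift_poly_commute)
  also have "\<dots> = (\<Sum>l<m - 1. coeff \<chi> l * snd (hom (p i (m - 1))))"
    using Q by (auto simp: shift_poly_eq_sum[OF deg] approximant_def intro!: sum.cong)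
  also have "\<dots> = of_nat k * snd (hom (p i (m - 1)))"
    using \<chi>_1 by (simp add: poly_1_eq_sum[OF deg] flip: sum_distrib_right)
  finally have eq: "fst (hom (p i (m - 1))) * ?\<sigma> = of_nat m * snd (hom (p i (m - 1)))"
    by (simp add: m)
  have sum: "(\<Sum>l = 0..m - 1. inverse (p (int l) 1)) = Of_complex ?\<sigma>"
    unfolding ivl by (rule sum_csphere_Of_complex) (rule S)
  show "p i (m - 1) =
      inverse (Of_complex (1 / of_nat m) * (\<Sum>l = 0..m - 1. inverse (p (int l) 1)))"
    \<comment> \<open>The homogeneous equation \<open>eq\<close> also settles the point
      \<open>Infty\<close>, which occurs exactly when the period sum is 0.\<close>
    unfolding sum using eq \<open>m \<ge> 2\<close> by (cases "p i (m - 1)") (auto simp: field_simps)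
qed

end
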